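(* Let $D$ be a minimal strong digraph, let $C_q$ be a directed cycle of length $q\ge 2$ contained in $D$, and let $D'$ be the digraph obtained from $D$ by deleting all arcs of $C_q$. If a strong component $S$ of $D'$ contains $\lambda>1$ vertices of $C_q$, then $S$ contains at least $\lambda$ vertices which are linear vertices of $D$.
   Context: An arc $uv$ of a digraph is transitive if there is another directed $uv$-path not using the arc $uv$. A minimal strong digraph is a strongly connected digraph with no transitive arcs. A strong component is a maximal strongly connected subdigraph. A vertex $v$ of $D$ is linear if its indegree and outdegree in $D$ are both equal to $1$. *)

theory Defs
  imports "Graph_Theory.Graph_Theory"
begin

definition transitive_arc :: "('a, 'b) pre_digraph \<Rightarrow> 'b \<Rightarrow> bool" where
  "transitive_arc D e \<longleftrightarrow>
     e \<in> arcs D \<and> (\<exists>p. pre_digraph.apath D (tail D e) p (head D e) \<and> e \<notin> set p)"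

text \<open>The locale \<^locale>\<open>digraph\<close> requires finiteness and excludes loops and parallel arcs;
  opposite arcs, hence 2-cycles, are allowed.\<close>

definition minimal_strong_digraph :: "('a, 'b) pre_digraph \<Rightarrow> bool" where
  "minimal_strong_digraph D \<longleftrightarrow>
     digraph D \<and> strongly_connected D \<and> (\<forall>e \<in> arcs D. \<not> transitive_arc D e)"

definition linear_vertex :: "('a, 'b) pre_digraph \<Rightarrow> 'a \<Rightarrow> bool" where
  "linear_vertex D v \<longleftrightarrow> v \<in> verts D \<and> in_degree D v = 1 \<and> out_degree D v = 1"

definition del_arcs :: "('a, 'b) pre_digraph \<Rightarrow> 'b set \<Rightarrow> ('a, 'b) pre_digraph" where
  "del_arcs D A = \<lparr>verts = verts D, arcs = arcs D - A, tail = tail D, head = head D\<rparr>"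

text \<open>A cycle is given by its list of arcs, so its vertices are the tails of these arcs.\<close>

definition cycle_verts :: "('a, 'b) pre_digraph \<Rightarrow> 'b list \<Rightarrow> 'a set" where
  "cycle_verts D c = tail D ` set c"

end

theory Submission
  imports Defs
begin

text \<open>
  Write \<open>K\<close> for the vertices of the cycle. The engine is an ear argument: if \<open>W \<supseteq> K\<close> induces a
  strong subdigraph and \<open>S\<close> is not contained in \<open>W\<close>, then some vertex of \<open>S - W\<close> is linear in \<open>D\<close>.
  Indeed, add to \<open>W\<close> shortest ears running inside \<open>S\<close> until \<open>S\<close> is exhausted, and look at the
  last ear. By minimality all arcs inside \<open>W \<union> S\<close> at an inner vertex of this ear are ear arcs, so a
  further arc leads out of \<open>W \<union> S\<close> and, \<open>S\<close> being a strong component, continues to \<open>K\<close> without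
  returning to \<open>S\<close> (dually for entering arcs). The last ear vertex has no such exit, as
  otherwise the final ear arc would be transitive; hence there is a first vertex after an exit (or
  after the start of the ear) which has no exit itself, and it cannot have a further entering arc
  either, as otherwise the ear arc leading to it would be transitive.

  Each \<open>t \<in> S \<inter> K\<close> has an arc \<open>e\<close> in \<open>S\<close> starting at \<open>t\<close>. The set \<open>W\<^sub>t\<close> of the vertices
  reachable from \<open>t\<close> without \<open>e\<close> contains \<open>K\<close>, is strong, and misses the head of \<open>e\<close>. The
  complements of the sets \<open>W\<^sub>t\<close> are pairwise disjoint, because a walk from \<open>K\<close> to a vertex,
  cut at its last visit to \<open>K\<close>, uses at most one of the chosen arcs. So the ear argument yields
  distinct linear vertices for distinct \<open>t\<close>.
\<close>

section \<open>Walks in a relation\<close>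

lemma rtrancl_first_hit:
  assumes "(b, c) \<in> E\<^sup>*" "c \<in> K"
  shows "\<exists>c'\<in>K. (b, c') \<in> {(x, y) \<in> E. x \<notin> K}\<^sup>*"
  using assms
proof (induction rule: converse_rtrancl_induct)
  case (step y z)
  then obtain c' where c': "c' \<in> K" "(z, c') \<in> {(x, y) \<in> E. x \<notin> K}\<^sup>*" by blast
  show ?case
  proof (cases "y \<in> K")
    case False
    then have "(y, z) \<in> {(x, y) \<in> E. x \<notin> K}" using step by auto
    with c' show ?thesis by (meson converse_rtrancl_into_rtrancl)
  qed blast
qed blast

lemma rtrancl_leaves_set:
  assumes "(a, b) \<in> R\<^sup>*" "a \<in> W" "b \<notin> W"
  shows "\<exists>x y. (x, y) \<in> R \<and> x \<in> W \<and> y \<notin> W"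
  using assms by (induction rule: rtrancl_induct) blast+

text \<open>Take a shortest walk from \<open>a\<close> to \<open>W\<close>: an earlier visit to
  \<open>W\<close> or a repeated vertex would allow a shorter one.\<close>

lemma shortest_path_to_set:
  assumes "(a, b) \<in> R\<^sup>*" "a \<notin> W" "b \<in> W"
  obtains f :: "nat \<Rightarrow> 'a" and n where
    "f 0 = a" "f n \<in> W" "0 < n" "\<And>i. i < n \<Longrightarrow> (f i, f (Suc i)) \<in> R"
    "\<And>i. i < n \<Longrightarrow> f i \<notin> W" "inj_on f {..n}"
proof -
  define P where "P n \<longleftrightarrow> (\<exists>w\<in>W. (a, w) \<in> R ^^ n)" for n
  have "\<exists>n. P n" using assms rtrancl_imp_relpow unfolding P_def by metis
  then have "P (LEAST n. P n)" and least: "\<And>m. m < (LEAST n. P n) \<Longrightarrow> \<not> P m"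
    using LeastI_ex not_less_Least by blast+
  then obtain n w where n: "n = (LEAST n. P n)" and w: "w \<in> W" "(a, w) \<in> R ^^ n"
    unfolding P_def by blast
  then obtain f where f: "f 0 = a" "f n = w" "\<And>i. i < n \<Longrightarrow> (f i, f (Suc i)) \<in> R"
    unfolding relpow_fun_conv by blast
  have pre: "(a, f i) \<in> R ^^ i" if "i \<le> n" for i
    unfolding relpow_fun_conv using that f by (intro exI[of _ f]) auto
  have suf: "(f i, w) \<in> R ^^ (n - i)" if "i \<le> n" for i
    unfolding relpow_fun_conv using that f by (intro exI[of _ "\<lambda>k. f (i + k)"]) auto
  have "f i \<noteq> f j" if "i < j" "j \<le> n" for i j
  proof
    assume "f i = f j"
    then have "(a, f j) \<in> R ^^ i" "(f j, w) \<in> R ^^ (n - j)" using pre[of i] suf[of j] that by auto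
    then have "(a, w) \<in> R ^^ (i + (n - j))" unfolding relpow_add by blast
    then have "P (i + (n - j))" using w unfolding P_def by blast
    with least[of "i + (n - j)"] that n show False by auto
  qed
  then have "inj_on f {..n}" by (metis atMost_iff inj_onI linorder_neqE_nat)
  moreover have "f i \<notin> W" if "i < n" for i
    using pre[of i] least[of i] that n unfolding P_def by auto
  moreover have "0 < n" using f w assms by (cases n) auto
  ultimately show ?thesis using that f w by blast
qed

lemma obtain_first_failure:
  fixes P :: "nat \<Rightarrow> bool"
  assumes "0 < n" "\<not> P (n - 1)"
  obtains j where "j < n" "\<not> P j" "j = 0 \<or> P (j - 1)"
proof -
  define j where "j = (LEAST j. \<not> P j)"
  have "\<not> P j" unfolding j_def by (rule LeastI) (rule assms(2))
  moreover have "j \<le> n - 1" unfolding j_def by (rule Least_le) (rule assms(2))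
  moreover have "j = 0 \<or> P (j - 1)"
    using not_less_Least[of "j - 1" "\<lambda>j. \<not> P j"] unfolding j_def[symmetric] by (cases j) auto
  ultimately show ?thesis using that[of j] assms by auto
qed

section \<open>Strong vertex sets and ears\<close>

definition strong_on :: "('a \<times> 'a) set \<Rightarrow> 'a set \<Rightarrow> bool" where
  "strong_on R W \<longleftrightarrow> (\<forall>u\<in>W. \<forall>v\<in>W. (u, v) \<in> (R \<inter> W \<times> W)\<^sup>*)"

lemma strong_on_rtrancl:
  "strong_on R W \<Longrightarrow> u \<in> W \<Longrightarrow> v \<in> W \<Longrightarrow> R \<inter> W \<times> W \<subseteq> Q \<Longrightarrow> (u, v) \<in> Q\<^sup>*"
  unfolding strong_on_def using rtrancl_mono by blast

text \<open>Along the ear and inside \<open>W\<close>, each vertex is reached from \<open>w\<close>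
  and reaches \<open>w\<close>. \<open>Q\<close> keeps only the ear and the old arcs, so that
  minimality can later exclude any other arc between these vertices.\<close>

lemma strong_on_add_ear:
  assumes "strong_on E W" "w \<in> W" "f n \<in> W"
    and Q: "Q = insert (w, f 0) ((\<lambda>i. (f i, f (Suc i))) ` {..<n}) \<union> E \<inter> W \<times> W"
  shows "strong_on Q (W \<union> f ` {..<n})"
proof -
  let ?W = "W \<union> f ` {..<n}" and ?R = "Q \<inter> (W \<union> f ` {..<n}) \<times> (W \<union> f ` {..<n})"
  have fW: "f i \<in> ?W" if "i \<le> n" for i using that assms(3) by (cases "i = n") auto
  have step: "(f i, f (Suc i)) \<in> ?R" if "i < n" for i
    using that fW[of i] fW[of "Suc i"] Q by auto
  have start: "(w, f 0) \<in> ?R" using fW[of 0] assms(2) Q by auto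
  have to_f: "(w, f i) \<in> ?R\<^sup>*" if "i \<le> n" for i
    using that
  proof (induction i)
    case (Suc i)
    then show ?case using step[of i] by (meson Suc_leD Suc_le_lessD rtrancl_into_rtrancl)
  qed (use start in blast)
  have from_f: "(f i, f n) \<in> ?R\<^sup>*" if "i \<le> n" for i
    using that
  proof (induction rule: inc_induct)
    case (step i)
    then show ?case using \<open>\<And>i. i < n \<Longrightarrow> (f i, f (Suc i)) \<in> ?R\<close>
      by (meson converse_rtrancl_into_rtrancl)
  qed blast
  have inW: "(u, v) \<in> ?R\<^sup>*" if "u \<in> W" "v \<in> W" for u v
    by (rule strong_on_rtrancl[OF assms(1) that]) (use Q in auto)
  have "(w, u) \<in> ?R\<^sup>*" if "u \<in> ?W" for u using that to_f inW assms(2) by auto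
  moreover have "(u, w) \<in> ?R\<^sup>*" if "u \<in> ?W" for u
  proof (cases "u \<in> W")
    case False
    then have "(u, f n) \<in> ?R\<^sup>*" using that from_f by auto
    then show ?thesis using inW[OF assms(3,2)] by (rule rtrancl_trans)
  qed (use inW assms(2) in blast)
  ultimately show ?thesis unfolding strong_on_def by (meson rtrancl_trans)
qed

section \<open>The ear argument\<close>

text \<open>
  Arcs are represented by the pairs of their end points. \<open>K\<close> and \<open>A\<close> are the vertices and the arcs
  of the cycle, \<open>S\<close> is the vertex set of the strong component.
\<close>

locale cycle_component =
  fixes V :: "'a set" and E :: "('a \<times> 'a) set" and K :: "'a set" and A :: "('a \<times> 'a) set"
    and S :: "'a set"
  assumes finite_V: "finite V"
    and E_subset: "E \<subseteq> V \<times> V"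
    and strong: "u \<in> V \<Longrightarrow> v \<in> V \<Longrightarrow> (u, v) \<in> E\<^sup>*"
    and minimal: "(u, v) \<in> E \<Longrightarrow> (u, v) \<notin> (E - {(u, v)})\<^sup>*"
    and A_subset: "A \<subseteq> E" "A \<subseteq> K \<times> K"
    and A_strong: "u \<in> K \<Longrightarrow> v \<in> K \<Longrightarrow> (u, v) \<in> A\<^sup>*"
    and K_subset: "K \<subseteq> V" and K_nonempty: "K \<noteq> {}"
    and S_subset: "S \<subseteq> V"
    and S_strong: "u \<in> S \<Longrightarrow> v \<in> S \<Longrightarrow> (u, v) \<in> (E \<inter> S \<times> S - A)\<^sup>*"
    and S_maximal: "u \<in> S \<Longrightarrow> (u, v) \<in> (E - A)\<^sup>* \<Longrightarrow> (v, u) \<in> (E - A)\<^sup>* \<Longrightarrow> v \<in> S"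
begin

text \<open>The assumptions are self-dual, so facts about entering arcs follow from those about
  leaving arcs.\<close>

lemma cycle_component_converse: "cycle_component V (E\<inverse>) K (A\<inverse>) S"
proof
  show "(u, v) \<notin> (E\<inverse> - {(u, v)})\<^sup>*" if "(u, v) \<in> E\<inverse>" for u v
  proof -
    have "E\<inverse> - {(u, v)} = (E - {(v, u)})\<inverse>" by auto
    then show ?thesis using minimal[of v u] that by (simp add: rtrancl_converse)
  qed
  show "(u, v) \<in> (E\<inverse> \<inter> S \<times> S - A\<inverse>)\<^sup>*" if "u \<in> S" "v \<in> S" for u v
  proof -
    have "E\<inverse> \<inter> S \<times> S - A\<inverse> = (E \<inter> S \<times> S - A)\<inverse>" by auto
    then show ?thesis using S_strong[of v u] that by (simp add: rtrancl_converse)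
  qed
  show "v \<in> S" if "u \<in> S" "(u, v) \<in> (E\<inverse> - A\<inverse>)\<^sup>*" "(v, u) \<in> (E\<inverse> - A\<inverse>)\<^sup>*" for u v
  proof -
    have "E\<inverse> - A\<inverse> = (E - A)\<inverse>" by auto
    then show ?thesis using S_maximal[of u v] that by (simp add: rtrancl_converse)
  qed
qed (use finite_V E_subset strong A_subset A_strong K_subset K_nonempty S_subset
      in \<open>auto simp: rtrancl_converse\<close>)

text \<open>A walk from \<open>b\<close> up to its first visit to \<open>K\<close> uses no cycle
  arc, as those start in \<open>K\<close>. If it met \<open>S\<close>, then \<open>b\<close> would
  lie on a closed walk through \<open>s\<close> avoiding \<open>A\<close>, and maximality would put
  \<open>b\<close> in \<open>S\<close>.\<close>

lemma exit_reaches_cycle: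
  assumes "s \<in> S" "(s, b) \<in> E" "s \<notin> K" "b \<notin> S"
  shows "\<exists>c\<in>K. (b, c) \<in> {(x, y) \<in> E. x \<notin> S}\<^sup>*"
proof -
  let ?F = "{(x, y) \<in> E. x \<notin> K}"
  obtain k where "k \<in> K" using K_nonempty by blast
  then have "(b, k) \<in> E\<^sup>*" using assms E_subset K_subset by (blast intro: strong)
  from rtrancl_first_hit[OF this \<open>k \<in> K\<close>]
  obtain c where c: "c \<in> K" "(b, c) \<in> ?F\<^sup>*" by (rule bexE)
  have F: "?F \<subseteq> E - A" using A_subset by auto
  have sb: "(s, b) \<in> E - A" using assms A_subset by auto
  have outside: "z \<notin> S" if "(b, z) \<in> ?F\<^sup>*" for z
  proof
    assume z: "z \<in> S"
    have "(b, z) \<in> (E - A)\<^sup>*" using that rtrancl_mono[OF F] by blast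
    moreover have "(z, s) \<in> (E - A)\<^sup>*"
      using S_strong[OF z assms(1)] rtrancl_mono[of "E \<inter> S \<times> S - A" "E - A"] by blast
    ultimately have "(b, s) \<in> (E - A)\<^sup>*" by auto
    then show False using S_maximal[of s b] sb assms by blast
  qed
  from c(2) have "(b, c) \<in> {(x, y) \<in> E. x \<notin> S}\<^sup>*"
  proof (induction rule: rtrancl_induct)
    case (step y z)
    then show ?case using outside[of y] by (auto intro: rtrancl_into_rtrancl)
  qed blast
  with c show ?thesis by blast
qed

lemma entry_reached_from_cycle:
  assumes "s \<in> S" "(b, s) \<in> E" "s \<notin> K" "b \<notin> S"
  shows "\<exists>c\<in>K. (c, b) \<in> {(x, y) \<in> E. y \<notin> S}\<^sup>*"
proof -
  interpret rev: cycle_component V "E\<inverse>" K "A\<inverse>" S by (rule cycle_component_converse)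
  have "{(x, y) \<in> E\<inverse>. x \<notin> S} = {(x, y) \<in> E. y \<notin> S}\<inverse>" by auto
  then show ?thesis using rev.exit_reaches_cycle[of s b] assms by (simp add: rtrancl_converse)
qed

text \<open>Otherwise \<open>Q\<close> would lead from \<open>u\<close> to \<open>v\<close> without
  the arc, against minimality.\<close>

lemma arcs_of_strong_subset:
  assumes "strong_on Q W" "Q \<subseteq> E" "(u, v) \<in> E" "u \<in> W" "v \<in> W"
  shows "(u, v) \<in> Q"
proof (rule ccontr)
  assume "(u, v) \<notin> Q"
  then have "Q \<inter> W \<times> W \<subseteq> E - {(u, v)}" using assms by auto
  then show False using strong_on_rtrancl[OF assms(1,4,5)] minimal[OF assms(3)] by blast
qed

text \<open>The case of the last ear: it exhausts \<open>S\<close>, so an arc leaving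
  \<open>W\<close> and the ear also leaves \<open>S\<close>.\<close>

lemma linear_vertex_on_ear:
  assumes W: "K \<subseteq> W" "strong_on E W"
    and ear: "(w, f 0) \<in> E" "w \<in> W" "f n \<in> W" "0 < n"
      "\<And>i. i < n \<Longrightarrow> (f i, f (Suc i)) \<in> E" "\<And>i. i < n \<Longrightarrow> f i \<in> S - W" "inj_on f {..n}"
    and Q: "Q = insert (w, f 0) ((\<lambda>i. (f i, f (Suc i))) ` {..<n}) \<union> E \<inter> W \<times> W"
      "strong_on Q (W \<union> f ` {..<n})"
    and S: "S \<subseteq> W \<union> f ` {..<n}"
  shows "\<exists>v\<in>S - W. (\<exists>x. E `` {v} = {x}) \<and> (\<exists>x. E\<inverse> `` {v} = {x})"
proof -
  let ?W = "W \<union> f ` {..<n}"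
  have QE: "Q \<subseteq> E" using Q ear by auto
  have inside: "(u, v) \<in> Q" if "(u, v) \<in> E" "u \<in> ?W" "v \<in> ?W" for u v
    using arcs_of_strong_subset[OF Q(2) QE that] .
  have f_inj: "f i = f j \<longleftrightarrow> i = j" if "i \<le> n" "j \<le> n" for i j
    using inj_on_eq_iff[OF ear(7)] that by auto
  have fW: "f i \<in> ?W" if "i \<le> n" for i using that ear(3) by (cases "i = n") auto
  \<comment> \<open>As \<open>f i\<close> lies outside \<open>W\<close>, only an ear arc of
    \<open>Q\<close> can start there, and injectivity of \<open>f\<close> fixes its index.\<close>
  have out: "y = f (Suc i)" if "i < n" "(f i, y) \<in> E" "y \<in> ?W" for i y
    using inside[OF that(2) fW that(3)] that(1) ear(6)[OF that(1)] ear(2) Q(1) by (auto simp: f_inj)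
  \<comment> \<open>The predecessor of \<open>f i\<close> on the ear; \<open>i = 0\<close> is
    separate because truncated subtraction would return \<open>f 0\<close>.\<close>
  define p where "p i = (if i = 0 then w else f (i - 1))" for i
  have p: "(p i, f i) \<in> E" "p i \<in> ?W" if "i < n" for i
    using that ear(1,2) ear(5)[of "i - 1"] unfolding p_def by auto
  have in_arc: "y = p i" if "i < n" "(y, f i) \<in> E" "y \<in> ?W" for i y
    using inside[OF that(2,3) fW] that(1) ear(6)[OF that(1)] Q(1) unfolding p_def
    by (auto simp: f_inj)
  define exits where "exits i \<longleftrightarrow> (\<exists>b. b \<notin> ?W \<and> (f i, b) \<in> E)" for i
  have exit: "\<exists>c\<in>K. (f i, c) \<in> (E - {(f i, y)})\<^sup>*" if i: "i < n" "exits i" and y: "y \<in> ?W" for i y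
  proof -
    obtain b where b: "b \<notin> ?W" "(f i, b) \<in> E" using i unfolding exits_def by blast
    have fi: "f i \<in> S" "f i \<notin> K" using ear(6)[OF i(1)] W by auto
    obtain c where c: "c \<in> K" "(b, c) \<in> {(x, y) \<in> E. x \<notin> S}\<^sup>*"
      using exit_reaches_cycle[OF fi(1) b(2) fi(2)] b S by blast
    have "{(x, y) \<in> E. x \<notin> S} \<subseteq> E - {(f i, y)}" using fi by auto
    then have "(b, c) \<in> (E - {(f i, y)})\<^sup>*" using c rtrancl_mono by blast
    moreover have "(f i, b) \<in> E - {(f i, y)}" using b y by auto
    ultimately show ?thesis using c by (meson converse_rtrancl_into_rtrancl)
  qed
  have entry: "\<exists>c\<in>K. (c, f i) \<in> (E - {(y, f i)})\<^sup>*"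
    if i: "i < n" and b: "b \<notin> ?W" "(b, f i) \<in> E" and y: "y \<in> ?W" for i b y
  proof -
    have fi: "f i \<in> S" "f i \<notin> K" using ear(6)[OF i(1)] W by auto
    obtain c where c: "c \<in> K" "(c, b) \<in> {(x, y) \<in> E. y \<notin> S}\<^sup>*"
      using entry_reached_from_cycle[OF fi(1) b(2) fi(2)] b S by blast
    have "{(x, y) \<in> E. y \<notin> S} \<subseteq> E - {(y, f i)}" using fi by auto
    then have "(c, b) \<in> (E - {(y, f i)})\<^sup>*" using c rtrancl_mono by blast
    moreover have "(b, f i) \<in> E - {(y, f i)}" using b y by auto
    ultimately show ?thesis using c by (meson rtrancl_into_rtrancl)
  qed
  have inW: "(u, v) \<in> (E - {(x, y)})\<^sup>*" if "u \<in> W" "v \<in> W" "x \<notin> W \<or> y \<notin> W" for u v x y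
    by (rule strong_on_rtrancl[OF W(2) that(1,2)]) (use that(3) in auto)
  \<comment> \<open>An exit here reaches \<open>K\<close> and continues inside \<open>W\<close> to
    \<open>f n\<close>, which would make the last ear arc transitive.\<close>
  have "\<not> exits (n - 1)"
  proof
    assume e: "exits (n - 1)"
    have n: "n - 1 < n" "Suc (n - 1) = n" using ear(4) by auto
    obtain c where c: "c \<in> K" "(f (n - 1), c) \<in> (E - {(f (n - 1), f n)})\<^sup>*"
      using exit[OF n(1) e fW[of n]] by auto
    moreover have "(c, f n) \<in> (E - {(f (n - 1), f n)})\<^sup>*"
      using inW[of c "f n"] c W ear(3) ear(6)[OF n(1)] by blast
    ultimately have "(f (n - 1), f n) \<in> (E - {(f (n - 1), f n)})\<^sup>*" by (meson rtrancl_trans)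
    then show False using minimal[of "f (n - 1)" "f n"] ear(5)[OF n(1)] n by auto
  qed
  then obtain j where j: "j < n" "\<not> exits j" "j = 0 \<or> exits (j - 1)"
    using obtain_first_failure[OF ear(4)] by blast
  have "E `` {f j} = {f (Suc j)}"
    using ear(5)[OF j(1)] out[OF j(1)] j(2) unfolding exits_def by blast
  moreover have "E\<inverse> `` {f j} = {p j}"
  proof -
    \<comment> \<open>Another entering arc closes a detour around \<open>(p j, f j)\<close>: from
      \<open>p j\<close> into \<open>W\<close> (at once if \<open>j = 0\<close>, else by the exit of
      \<open>f (j - 1)\<close>), inside \<open>W\<close> to \<open>c\<close>, and from
      \<open>c\<close> to \<open>f j\<close>.\<close>
    have False if b: "b \<notin> ?W" "(b, f j) \<in> E" for b
    proof -
      obtain c where c: "c \<in> K" "(c, f j) \<in> (E - {(p j, f j)})\<^sup>*"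
        using entry[OF j(1) b p(2)[OF j(1)]] by blast
      have "\<exists>c'\<in>W. (p j, c') \<in> (E - {(p j, f j)})\<^sup>*"
      proof (cases "j = 0")
        case True
        then show ?thesis using ear(2) unfolding p_def by auto
      next
        case False
        then have "\<exists>c\<in>K. (f (j - 1), c) \<in> (E - {(f (j - 1), f j)})\<^sup>*" using j fW by (intro exit) auto
        then show ?thesis using False W(1) unfolding p_def by auto
      qed
      then obtain c' where c': "c' \<in> W" "(p j, c') \<in> (E - {(p j, f j)})\<^sup>*" by blast
      have "(c', c) \<in> (E - {(p j, f j)})\<^sup>*"
        using inW[of c' c] c' c W(1) ear(6)[OF j(1)] by blast
      with c c' have "(p j, f j) \<in> (E - {(p j, f j)})\<^sup>*" by (meson rtrancl_trans)
      then show False using minimal p(1)[OF j(1)] by blast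
    qed
    then show ?thesis using p(1)[OF j(1)] in_arc[OF j(1)] by blast
  qed
  ultimately show ?thesis using ear(6)[OF j(1)] by blast
qed

text \<open>Ears inside \<open>S\<close> are added by induction on the size of \<open>S - W\<close>,
  which drops because each ear absorbs at least its first vertex \<open>s\<close>. A vertex in
  \<open>S \<inter> W\<close> lets \<open>S\<close> supply both the arc leaving \<open>W\<close> and
  the way back.\<close>

lemma linear_vertex_outside_strong_set:
  assumes "K \<subseteq> W" "strong_on E W" "S \<inter> W \<noteq> {}" "S - W \<noteq> {}"
  shows "\<exists>v\<in>S - W. (\<exists>x. E `` {v} = {x}) \<and> (\<exists>x. E\<inverse> `` {v} = {x})"
  using assms
proof (induction "card (S - W)" arbitrary: W rule: less_induct)
  case less
  let ?F = "E \<inter> S \<times> S - A"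
  obtain w0 u0 where wu: "w0 \<in> S \<inter> W" "u0 \<in> S - W" using less.prems by blast
  obtain w s where ws: "(w, s) \<in> ?F" "w \<in> W" "s \<notin> W"
    using rtrancl_leaves_set[of w0 u0 ?F W] S_strong[of w0 u0] wu by blast
  have "(s, w0) \<in> ?F\<^sup>*" using S_strong ws wu by blast
  then obtain f n where f: "f 0 = s" "f n \<in> W" "0 < n" "\<And>i. i < n \<Longrightarrow> (f i, f (Suc i)) \<in> ?F"
    "\<And>i. i < n \<Longrightarrow> f i \<notin> W" "inj_on f {..n}"
    using shortest_path_to_set[of s w0 ?F W] ws wu by blast
  define Q where "Q = insert (w, f 0) ((\<lambda>i. (f i, f (Suc i))) ` {..<n}) \<union> E \<inter> W \<times> W"
  define W' where "W' = W \<union> f ` {..<n}"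
  have Q: "strong_on Q W'" unfolding W'_def using less.prems ws f
    by (intro strong_on_add_ear[OF _ _ _ Q_def])
  show ?case
  proof (cases "S \<subseteq> W'")
    case True
    show ?thesis
      by (rule linear_vertex_on_ear[OF less.prems(1,2) _ ws(2) f(2,3) _ _ f(6) Q_def
            Q[unfolded W'_def] True[unfolded W'_def]]) (use ws f in auto)
  next
    case False
    have "Q \<subseteq> E" using ws f(1,4) unfolding Q_def by auto
    then have "Q \<inter> W' \<times> W' \<subseteq> E \<inter> W' \<times> W'" by auto
    then have E: "strong_on E W'" using Q rtrancl_mono unfolding strong_on_def by blast
    have "s \<in> S - W" "s \<in> W'" using ws f(1,3) unfolding W'_def by auto
    then have "S - W' \<subset> S - W" unfolding W'_def by blast
    then have "card (S - W') < card (S - W)"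
      using finite_subset[OF S_subset finite_V] by (intro psubset_card_mono) auto
    from less.hyps[OF this _ E] have "\<exists>v\<in>S - W'. (\<exists>x. E `` {v} = {x}) \<and> (\<exists>x. E\<inverse> `` {v} = {x})"
      using less.prems False unfolding W'_def by blast
    then show ?thesis unfolding W'_def by blast
  qed
qed

section \<open>Vertices reachable without a chosen arc\<close>

lemma cycle_reaches_by_one_cycle_arc:
  assumes "y \<in> V"
  shows "\<exists>c\<in>K. (c, y) \<in> {(a, b) \<in> E. a \<in> K \<longrightarrow> a = c}\<^sup>*"
proof -
  obtain k where k: "k \<in> K" using K_nonempty by blast
  then have "(y, k) \<in> (E\<inverse>)\<^sup>*" using strong[of k y] assms K_subset by (auto simp: rtrancl_converse)
  from rtrancl_first_hit[OF this k] obtain c where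
    c: "c \<in> K" "(y, c) \<in> {(a, b) \<in> E\<inverse>. a \<notin> K}\<^sup>*" by blast
  have "{(a, b) \<in> E\<inverse>. a \<notin> K} = {(a, b) \<in> E. b \<notin> K}\<inverse>" by auto
  with c have "(c, y) \<in> {(a, b) \<in> E. b \<notin> K}\<^sup>*" by (simp add: rtrancl_converse)
  \<comment> \<open>The reversed walk was cut at its first visit to \<open>K\<close>, so
    \<open>c\<close> is the last visit. The added disjunction makes every tail on the walk
    admissible.\<close>
  then have "(c, y) \<in> {(a, b) \<in> E. a \<in> K \<longrightarrow> a = c}\<^sup>* \<and> (y = c \<or> y \<notin> K)"
  proof (induction rule: rtrancl_induct)
    case (step z z')
    then have "(z, z') \<in> {(a, b) \<in> E. a \<in> K \<longrightarrow> a = c}" by auto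
    with step show ?case by (auto intro: rtrancl_into_rtrancl)
  qed blast
  with c show ?thesis by blast
qed

text \<open>For the arc chosen at \<open>t\<close> this is the set \<open>W\<^sub>t\<close> of the
  overview.\<close>

definition reach_without :: "'a \<times> 'a \<Rightarrow> 'a set" where
  "reach_without e = {y. (fst e, y) \<in> (E - {e})\<^sup>*}"

lemma cycle_subset_reach_without:
  assumes "t \<in> K" "(t, x) \<in> E - A"
  shows "K \<subseteq> reach_without (t, x)"
proof -
  have "A \<subseteq> E - {(t, x)}" using assms A_subset by auto
  then show ?thesis
    using A_strong[OF assms(1)] rtrancl_mono[of A] unfolding reach_without_def by auto
qed

text \<open>A walk back to \<open>t\<close>, stopped at its first visit to \<open>t\<close>, has no
  arc starting at \<open>t\<close> and so avoids the deleted arc. Walks avoiding that arc never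
  leave the set.\<close>

lemma strong_on_reach_without:
  assumes "t \<in> V"
  shows "strong_on E (reach_without (t, x))"
proof -
  let ?W = "reach_without (t, x)" and ?E = "E - {(t, x)}"
  have stay: "(u, v) \<in> (E \<inter> ?W \<times> ?W)\<^sup>*" if "u \<in> ?W" "(u, v) \<in> ?E\<^sup>*" for u v
    using that(2,1)
  proof (induction rule: converse_rtrancl_induct)
    case (step u z)
    then have "z \<in> ?W" unfolding reach_without_def by (auto intro: rtrancl_into_rtrancl)
    with step show ?case by (auto intro: converse_rtrancl_into_rtrancl)
  qed blast
  have "(t, v) \<in> (E \<inter> ?W \<times> ?W)\<^sup>*" if "v \<in> ?W" for v
    using stay[of t v] that unfolding reach_without_def by auto
  moreover have "(u, t) \<in> (E \<inter> ?W \<times> ?W)\<^sup>*" if "u \<in> ?W" for u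
  proof -
    have "u \<in> V" using that assms E_subset unfolding reach_without_def
      by (auto elim: rtranclE)
    then have "(u, t) \<in> E\<^sup>*" using strong assms by blast
    from rtrancl_first_hit[OF this, of "{t}"] have "(u, t) \<in> {(x, y) \<in> E. x \<notin> {t}}\<^sup>*" by blast
    then have "(u, t) \<in> ?E\<^sup>*" using rtrancl_mono[of "{(x, y) \<in> E. x \<notin> {t}}" ?E] by auto
    then show ?thesis using stay that by blast
  qed
  ultimately show ?thesis unfolding strong_on_def by (meson rtrancl_trans)
qed

text \<open>Some walk from \<open>c\<close> in \<open>K\<close> to \<open>y\<close> has no arc
  starting in \<open>K\<close> except at \<open>c\<close>. It avoids the arc chosen at whichever of
  \<open>t\<close> and \<open>t'\<close> differs from \<open>c\<close>, and that vertex reaches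
  \<open>c\<close> along the cycle.\<close>

lemma reach_without_cover:
  assumes "t \<in> K" "t' \<in> K" "t \<noteq> t'" "(t, x) \<in> E - A" "(t', x') \<in> E - A" "y \<in> V"
  shows "y \<in> reach_without (t, x) \<union> reach_without (t', x')"
proof -
  obtain c where c: "c \<in> K" "(c, y) \<in> {(a, b) \<in> E. a \<in> K \<longrightarrow> a = c}\<^sup>*"
    using cycle_reaches_by_one_cycle_arc[OF assms(6)] by blast
  have "y \<in> reach_without (r, z)" if "r \<in> K" "r \<noteq> c" "(r, z) \<in> E - A" for r z
  proof -
    have "{(a, b) \<in> E. a \<in> K \<longrightarrow> a = c} \<subseteq> E - {(r, z)}" using that by auto
    then have "(c, y) \<in> (E - {(r, z)})\<^sup>*" using c rtrancl_mono by blast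
    moreover have "(r, c) \<in> (E - {(r, z)})\<^sup>*"
      using cycle_subset_reach_without[OF that(1,3)] c unfolding reach_without_def by auto
    ultimately show ?thesis unfolding reach_without_def by auto
  qed
  then show ?thesis using assms by (cases "t = c") auto
qed

theorem card_linear_vertices:
  assumes "card (S \<inter> K) > 1"
  shows "card (S \<inter> K) \<le>
    card {v \<in> S. (\<exists>x. E `` {v} = {x}) \<and> (\<exists>x. E\<inverse> `` {v} = {x})}" (is "_ \<le> card ?L")
proof -
  \<comment> \<open>A walk inside \<open>S\<close> from \<open>t\<close> to a second vertex of
    \<open>S\<close> has a first arc.\<close>
  have "\<exists>x. (t, x) \<in> E \<inter> S \<times> S - A" if t: "t \<in> S \<inter> K" for t
  proof -
    obtain t' where "t' \<in> S" "t' \<noteq> t"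
      using assms t by (metis IntD1 One_nat_def card_le_Suc0_iff_eq card.infinite not_less zero_le)
    then show ?thesis using S_strong[of t t'] t by (auto elim: converse_rtranclE)
  qed
  then obtain x where x: "\<And>t. t \<in> S \<inter> K \<Longrightarrow> (t, x t) \<in> E \<inter> S \<times> S - A" by metis
  define W where "W t = reach_without (t, x t)" for t
  have "\<exists>v. v \<in> S - W t \<and> (\<exists>x. E `` {v} = {x}) \<and> (\<exists>x. E\<inverse> `` {v} = {x})" if t: "t \<in> S \<inter> K" for t
  proof -
    have xt: "(t, x t) \<in> E - A" "t \<in> K" using x[OF t] t by auto
    have "K \<subseteq> W t" unfolding W_def by (rule cycle_subset_reach_without[OF xt(2,1)])
    moreover have "strong_on E (W t)" unfolding W_def using t S_subset
      by (intro strong_on_reach_without) auto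
    \<comment> \<open>The chosen arc is not transitive, so its head is unreachable without
      it.\<close>
    moreover have "x t \<in> S - W t" using x[OF t] minimal unfolding W_def reach_without_def by auto
    ultimately show ?thesis using linear_vertex_outside_strong_set[of "W t"] t by blast
  qed
  then obtain v where v: "\<And>t. t \<in> S \<inter> K \<Longrightarrow> v t \<in> ?L" "\<And>t. t \<in> S \<inter> K \<Longrightarrow> v t \<notin> W t" by auto metis
  \<comment> \<open>A common value would lie outside both \<open>W t\<close> and
    \<open>W t'\<close>, which together cover \<open>V\<close>.\<close>
  have "inj_on v (S \<inter> K)"
  proof (rule inj_onI, rule ccontr)
    fix t t' assume *: "t \<in> S \<inter> K" "t' \<in> S \<inter> K" "v t = v t'" "t \<noteq> t'"
    then have "v t \<in> W t \<union> W t'" unfolding W_def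
      using x[of t] x[of t'] v(1)[of t] S_subset by (intro reach_without_cover) auto
    then show False using v(2)[of t] v(2)[of t'] * by auto
  qed
  moreover have "v ` (S \<inter> K) \<subseteq> ?L" using v by blast
  moreover have "finite ?L" using finite_subset[OF S_subset finite_V] by auto
  ultimately show ?thesis by (meson card_inj_on_le)
qed

end

section \<open>From digraphs to arc relations\<close>

lemma (in pre_digraph) cas_rtrancl:
  assumes "cas u p v" "e \<in> set p"
  shows "(u, tail G e) \<in> (arc_to_ends G ` set p)\<^sup>*" "(head G e, v) \<in> (arc_to_ends G ` set p)\<^sup>*"
    and "head G e \<in> insert v (tail G ` set p)"
proof -
  \<comment> \<open>The last conjunct is added for the induction: it gives the walk from
    \<open>head G a\<close> to \<open>v\<close>. Applying the hypothesis takes an arc of the rest,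
    hence the separate case of an empty rest.\<close>
  have "(u, tail G e) \<in> (arc_to_ends G ` set p)\<^sup>* \<and> (head G e, v) \<in> (arc_to_ends G ` set p)\<^sup>*
    \<and> head G e \<in> insert v (tail G ` set p) \<and> (u, v) \<in> (arc_to_ends G ` set p)\<^sup>*"
    using assms
  proof (induction p arbitrary: u e)
    case (Cons a p)
    let ?R = "arc_to_ends G ` set (a # p)"
    have mono: "(arc_to_ends G ` set p)\<^sup>* \<subseteq> ?R\<^sup>*" by (intro rtrancl_mono) auto
    have a: "(u, head G a) \<in> ?R" and p: "cas (head G a) p v"
      using Cons.prems by (auto simp: arc_to_ends_def)
    show ?case
    proof (cases "p = []")
      case True
      then show ?thesis using Cons.prems a by auto
    next
      case False
      then obtain b where b: "b \<in> set p" "tail G b = head G a" using p by (cases p) auto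
      have av: "(head G a, v) \<in> ?R\<^sup>*" using Cons.IH[OF p b(1)] mono by blast
      show ?thesis
      proof (cases "e = a")
        case True
        then show ?thesis using Cons.prems a av b by (force intro: converse_rtrancl_into_rtrancl)
      next
        case False
        then have e: "e \<in> set p" using Cons.prems by simp
        have "(head G a, tail G e) \<in> ?R\<^sup>*" "(head G e, v) \<in> ?R\<^sup>*"
          "head G e \<in> insert v (tail G ` set (a # p))"
          using Cons.IH[OF p e] mono by auto
        then show ?thesis using a av by (meson converse_rtrancl_into_rtrancl)
      qed
    qed
  qed simp
  then show "(u, tail G e) \<in> (arc_to_ends G ` set p)\<^sup>*"
    "(head G e, v) \<in> (arc_to_ends G ` set p)\<^sup>*" "head G e \<in> insert v (tail G ` set p)" by auto
qed

text \<open>From any cycle vertex one follows the cycle to its base point \<open>u\<close> and from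
  there to the target.\<close>

lemma (in pre_digraph) cycle_strong:
  assumes "cycle p"
  defines "R \<equiv> arc_to_ends G ` set p"
  shows "R \<subseteq> tail G ` set p \<times> tail G ` set p"
    and "x \<in> tail G ` set p \<Longrightarrow> y \<in> tail G ` set p \<Longrightarrow> (x, y) \<in> R\<^sup>*"
proof -
  obtain u where u: "cas u p u" "p \<noteq> []" using assms unfolding cycle_def awalk_def by blast
  then have "u \<in> tail G ` set p" by (cases p) auto
  then show "R \<subseteq> tail G ` set p \<times> tail G ` set p"
    using cas_rtrancl(3)[OF u(1)] unfolding R_def arc_to_ends_def by fastforce
  assume "x \<in> tail G ` set p" "y \<in> tail G ` set p"
  then obtain a b where a: "a \<in> set p" "tail G a = x" and b: "b \<in> set p" "tail G b = y" by blast
  have "(x, head G a) \<in> R" using a unfolding R_def arc_to_ends_def by auto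
  moreover have "(head G a, u) \<in> R\<^sup>*" "(u, y) \<in> R\<^sup>*"
    using cas_rtrancl[OF u(1)] a b unfolding R_def by auto
  ultimately show "(x, y) \<in> R\<^sup>*" by (meson converse_rtrancl_into_rtrancl rtrancl_trans)
qed

text \<open>Without parallel arcs \<open>arc_to_ends\<close> is injective, so its image commutes
  with set difference.\<close>

lemma (in digraph) arcs_ends_del_arcs:
  assumes "A \<subseteq> arcs G"
  shows "arcs_ends (del_arcs G A) = arcs_ends G - arc_to_ends G ` A"
proof -
  have "arc_to_ends (del_arcs G A) = arc_to_ends G"
    by (auto simp: arc_to_ends_def del_arcs_def fun_eq_iff)
  moreover have "inj_on (arc_to_ends G) (arcs G)" by (auto intro: inj_onI no_multi_arcs)
  then have "arc_to_ends G ` (arcs G - A) = arc_to_ends G ` arcs G - arc_to_ends G ` A"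
    using assms by (intro inj_on_image_set_diff) auto
  ultimately show ?thesis unfolding arcs_ends_def by (simp add: del_arcs_def)
qed

lemma (in wf_digraph) wf_digraph_del_arcs: "wf_digraph (del_arcs G A)"
  by unfold_locales (auto simp: del_arcs_def)

lemma (in wf_digraph) rtrancl_imp_reachable:
  assumes "(u, v) \<in> (arcs_ends G)\<^sup>*" "u \<in> verts G"
  shows "u \<rightarrow>\<^sup>* v"
  using assms by (induction rule: rtrancl_induct) (auto intro: reachable_adj_trans)

text \<open>The walk survives in \<open>del_arcs G {e}\<close>; a path extracted there is a path of
  \<open>G\<close> that misses \<open>e\<close>.\<close>

lemma (in digraph) transitive_arcI:
  assumes e: "e \<in> arcs G" and path: "arc_to_ends G e \<in> (arcs_ends G - {arc_to_ends G e})\<^sup>*"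
  shows "transitive_arc G e"
proof -
  interpret H: wf_digraph "del_arcs G {e}" by (rule wf_digraph_del_arcs)
  have "(tail G e, head G e) \<in> (arcs_ends (del_arcs G {e}))\<^sup>*"
    using arcs_ends_del_arcs[of "{e}"] e path by (simp add: arc_to_ends_def)
  then have "tail G e \<rightarrow>\<^sup>*\<^bsub>del_arcs G {e}\<^esub> head G e"
    using e by (intro H.rtrancl_imp_reachable) (auto simp: del_arcs_def)
  then obtain p where p: "pre_digraph.apath (del_arcs G {e}) (tail G e) p (head G e)"
    using H.reachable_apath by blast
  then have "e \<notin> set p"
    unfolding pre_digraph.apath_def pre_digraph.awalk_def by (auto simp: del_arcs_def)
  moreover have "subgraph (del_arcs G {e}) G"
    using H.wf_digraph_axioms wf_digraph_axioms
    by (auto simp: subgraph_def compatible_def del_arcs_def)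
  then have "apath (tail G e) p (head G e)" using subgraph_apath_imp_apath p by blast
  ultimately show ?thesis unfolding transitive_arc_def using e by blast
qed

lemma (in nomulti_digraph) linear_vertexI:
  assumes "arcs_ends G `` {v} = {x}" "(arcs_ends G)\<inverse> `` {v} = {y}"
  shows "linear_vertex G v"
proof -
  have vx: "(v, x) \<in> arcs_ends G" and yv: "(y, v) \<in> arcs_ends G" using assms by auto
  obtain a where a: "a \<in> arcs G" "arc_to_ends G a = (v, x)"
    using vx unfolding arcs_ends_def by auto
  obtain b where b: "b \<in> arcs G" "arc_to_ends G b = (y, v)"
    using yv unfolding arcs_ends_def by auto
  have "arc_to_ends G c = (v, x)" if "c \<in> arcs G" "tail G c = v" for c
    using assms(1) that unfolding arcs_ends_def arc_to_ends_def by auto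
  then have "out_arcs G v = {a}"
    using a no_multi_arcs by (auto simp: out_arcs_def arc_to_ends_def)
  moreover have "arc_to_ends G c = (y, v)" if "c \<in> arcs G" "head G c = v" for c
    using assms(2) that unfolding arcs_ends_def arc_to_ends_def by auto
  then have "in_arcs G v = {b}"
    using b no_multi_arcs by (auto simp: in_arcs_def arc_to_ends_def)
  moreover have "v \<in> verts G" using a by (auto simp: arc_to_ends_def)
  ultimately show ?thesis unfolding linear_vertex_def in_degree_def out_degree_def by simp
qed

text \<open>The vertex set of a strong component is a class of mutual reachability, which yields the
  maximality assumed in \<open>cycle_component\<close>.\<close>

lemma (in wf_digraph) scc_strong:
  assumes "H \<in> sccs"
  shows "verts H \<subseteq> verts G"
    and "u \<in> verts H \<Longrightarrow> v \<in> verts H \<Longrightarrow> (u, v) \<in> (arcs_ends G \<inter> verts H \<times> verts H)\<^sup>*"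
    and "u \<in> verts H \<Longrightarrow> (u, v) \<in> (arcs_ends G)\<^sup>* \<Longrightarrow> (v, u) \<in> (arcs_ends G)\<^sup>* \<Longrightarrow> v \<in> verts H"
proof -
  have ind: "induced_subgraph H G" and str: "strongly_connected H"
    using assms by (auto simp: sccs_def)
  have sub: "subgraph H G" using ind by (rule induced_imp_subgraph)
  interpret H: wf_digraph H using sub by (auto simp: subgraph_def)
  show VH: "verts H \<subseteq> verts G" using sub by (auto simp: subgraph_def)
  have ends: "arcs_ends H \<subseteq> arcs_ends G \<inter> verts H \<times> verts H"
    using arcs_ends_mono[OF sub] by (auto dest: H.adj_in_verts)
  show "(u, v) \<in> (arcs_ends G \<inter> verts H \<times> verts H)\<^sup>*" if "u \<in> verts H" "v \<in> verts H"
  proof -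
    have "(u, v) \<in> (arcs_ends H)\<^sup>*"
      using str that unfolding strongly_connected_def reachable_def
      by (blast intro: rtrancl_on_rtranclI)
    then show ?thesis using rtrancl_mono[OF ends] by blast
  qed
  have "verts H \<in> sccs_verts" using assms sccs_conv_sccs_verts by auto
  then obtain w where w: "verts H = scc_of w" unfolding sccs_verts_conv_scc_of by blast
  assume u: "u \<in> verts H" and uv: "(u, v) \<in> (arcs_ends G)\<^sup>*" "(v, u) \<in> (arcs_ends G)\<^sup>*"
  have "u \<rightarrow>\<^sup>* v" using rtrancl_imp_reachable[OF uv(1)] u VH by blast
  moreover have "v \<rightarrow>\<^sup>* u"
    using rtrancl_imp_reachable[OF uv(2)] reachable_in_verts(2) calculation by blast
  ultimately show "v \<in> verts H" using u unfolding w scc_of_def by (auto intro: reachable_trans)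
qed

theorem theorem3:
  fixes D S :: "('a, 'b) pre_digraph" and C :: "'b list" and q l :: nat
  assumes "minimal_strong_digraph D"
    and "pre_digraph.cycle D C" and "length C = q" and "q \<ge> 2"
    and "S \<in> pre_digraph.sccs (del_arcs D (set C))"
    and "l = card (verts S \<inter> cycle_verts D C)" and "l > 1"
  shows "card {v \<in> verts S. linear_vertex D v} \<ge> l"
proof -
  interpret digraph D using assms(1) unfolding minimal_strong_digraph_def by blast
  interpret D': wf_digraph "del_arcs D (set C)" by (rule wf_digraph_del_arcs)
  have C: "set C \<subseteq> arcs D" "C \<noteq> []" using assms(2) unfolding cycle_def awalk_def by auto
  let ?E = "arcs_ends D" and ?A = "arc_to_ends D ` set C" and ?K = "cycle_verts D C"
  have E': "arcs_ends (del_arcs D (set C)) = ?E - ?A" using arcs_ends_del_arcs[OF C(1)] .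
  note scc = D'.scc_strong[OF assms(5), unfolded E']
  interpret cycle_component "verts D" ?E ?K ?A "verts S"
  proof
    show "finite (verts D)" by simp
    show "?E \<subseteq> verts D \<times> verts D" by (auto dest: adj_in_verts)
    show "(u, v) \<in> ?E\<^sup>*" if "u \<in> verts D" "v \<in> verts D" for u v
      using assms(1) that
      unfolding minimal_strong_digraph_def strongly_connected_def reachable_def
      by (blast intro: rtrancl_on_rtranclI)
    show "(u, v) \<notin> (?E - {(u, v)})\<^sup>*" if uv: "(u, v) \<in> ?E" for u v
    proof -
      obtain e where e: "e \<in> arcs D" "arc_to_ends D e = (u, v)"
        using uv unfolding arcs_ends_def by auto
      then show ?thesis using transitive_arcI[of e] assms(1)
        unfolding minimal_strong_digraph_def by auto
    qed
    show "?A \<subseteq> ?E" using C unfolding arcs_ends_def by auto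
    show "?A \<subseteq> ?K \<times> ?K" using cycle_strong(1)[OF assms(2)] unfolding cycle_verts_def .
    show "(u, v) \<in> ?A\<^sup>*" if "u \<in> ?K" "v \<in> ?K" for u v
      using cycle_strong(2)[OF assms(2)] that unfolding cycle_verts_def by blast
    show "?K \<subseteq> verts D" "?K \<noteq> {}" using C unfolding cycle_verts_def by auto
    show "verts S \<subseteq> verts D" using scc(1) by (simp add: del_arcs_def)
    show "(u, v) \<in> (?E \<inter> verts S \<times> verts S - ?A)\<^sup>*" if "u \<in> verts S" "v \<in> verts S" for u v
    proof -
      have "(?E - ?A) \<inter> verts S \<times> verts S = ?E \<inter> verts S \<times> verts S - ?A" by blast
      then show ?thesis using scc(2)[OF that] by simp
    qed
  qed (use scc(3) in blast)
  have "l \<le> card {v \<in> verts S. (\<exists>x. ?E `` {v} = {x}) \<and> (\<exists>x. ?E\<inverse> `` {v} = {x})}"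
    using card_linear_vertices assms(6,7) by blast
  also have "\<dots> \<le> card {v \<in> verts S. linear_vertex D v}"
    using finite_subset[OF S_subset finite_V]
    by (intro card_mono) (auto intro: linear_vertexI)
  finally show ?thesis .
qed

end
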